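(* Let $n_1,\dots,n_s$ be positive integers, $n=\sum_l n_l$, $M=\bigoplus_{l=1}^s\mathbb{Z}^{n_l}$ with coordinates $b_{j,l}$ ($l=1,\dots,s$, $j=1,\dots,n_l$), and positive integers $d_{i,l}$ ($i=0,\dots,n$). Let $\mathcal{A}_i=\{b\in M: b_{j,l}\ge0,\ \sum_{j=1}^{n_l}b_{j,l}\le d_{i,l}\ \forall l\}$ and $\overline{\mathcal{A}}_i=\{b\in M:0\le\sum_{J=j}^{n_l}b_{J,l}\le d_{i,l}\ \forall l,j\}$, with $\Delta_i,\overline{\Delta}_i$ their convex hulls and $\Delta=\sum_i\Delta_i$, $\overline{\Delta}=\sum_i\overline{\Delta}_i$. Let $v\in\mathbb{R}^n$ satisfy $\langle v,w_{j,l}\rangle<0$ for all $l,j$, where $w_{1,l}=e_{1,l}$ and $w_{j,l}=e_{j,l}-e_{j-1,l}$ for $j\ge2$. Let $\lambda_0>\dots>\lambda_n\ge0$ be sufficiently small, let $S(\rho)$ be the mixed subdivision of $\Delta$ induced by the liftings $\omega_i(x)=\lambda_i\langle v,x\rangle$ on $\mathcal{A}_i$, and $S(\overline{\rho})$ the mixed subdivision of $\overline{\Delta}$ induced by the same formulas on $\overline{\mathcal{A}}_i$. Then $S(\rho)$ coincides with $S(\overline{\rho})\cap\Delta$, i.e. the cells of $S(\rho)$ are exactly the nonempty intersections of cells of $S(\overline{\rho})$ with $\Delta\subseteq\overline{\Delta}$.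
   Context: $e_{j,l}$ denotes the standard basis vector of $M$ for coordinate $b_{j,l}$. A lifting $\theta_i$ on each $\mathcal{A}_i$ induces a coherent mixed subdivision of the Minkowski sum: its cells are the projections of the lower faces of $\sum_i\mathrm{conv}\{(a,\theta_i(a)):a\in\mathcal{A}_i\}$.
   Formalization: Cells of S(ρ) are shown to be exactly the nonempty intersections of cells of S(ρ̄) with faces of Δ; with Δ alone this fails for cells in the boundary of Δ. Nonempty intersections with Δ are cells, and the full-dimensional cells are exactly the full-dimensional intersections. *)

theory Defs
  imports "HOL-Analysis.Analysis" "HOL-Library.Set_Algebras"
begin

text \<open>
  The space \<open>M \<otimes> \<real>\<close> is \<open>real ^ 'k\<close>. The labels of its coordinates are given by a map \<open>ix\<close>,
  which is to be a bijection from \<open>block_index s n\<close> onto \<open>'k\<close>; then \<open>b $ ix j l\<close> is the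
  coordinate \<open>b\<^sub>j\<^sub>,\<^sub>l\<close> and \<open>CARD('k)\<close> is the sum of the \<open>n l\<close>. Blocks \<open>l\<close> and positions \<open>j\<close>
  inside a block are counted from 1.
\<close>

definition block_index :: "nat \<Rightarrow> (nat \<Rightarrow> nat) \<Rightarrow> (nat \<times> nat) set" where
  "block_index s n = {(j, l). l \<in> {1..s} \<and> j \<in> {1..n l}}"

definition lattice_points :: "(real ^ 'k) set" where
  "lattice_points = {b. \<forall>k. b $ k \<in> \<int>}"

definition simplex_support ::
  "(nat \<Rightarrow> nat \<Rightarrow> 'k::finite) \<Rightarrow> nat \<Rightarrow> (nat \<Rightarrow> nat) \<Rightarrow> (nat \<Rightarrow> nat) \<Rightarrow> (real ^ 'k) set" where
  "simplex_support ix s n \<delta> =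
     {b \<in> lattice_points.
        (\<forall>l\<in>{1..s}. \<forall>j\<in>{1..n l}. 0 \<le> b $ ix j l) \<and>
        (\<forall>l\<in>{1..s}. (\<Sum>j=1..n l. b $ ix j l) \<le> real (\<delta> l))}"

definition box_support ::
  "(nat \<Rightarrow> nat \<Rightarrow> 'k::finite) \<Rightarrow> nat \<Rightarrow> (nat \<Rightarrow> nat) \<Rightarrow> (nat \<Rightarrow> nat) \<Rightarrow> (real ^ 'k) set" where
  "box_support ix s n \<delta> =
     {b \<in> lattice_points.
        \<forall>l\<in>{1..s}. \<forall>j\<in>{1..n l}.
          0 \<le> (\<Sum>J=j..n l. b $ ix J l) \<and> (\<Sum>J=j..n l. b $ ix J l) \<le> real (\<delta> l)}"

definition w_vec :: "(nat \<Rightarrow> nat \<Rightarrow> 'k::finite) \<Rightarrow> nat \<Rightarrow> nat \<Rightarrow> real ^ 'k" where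
  "w_vec ix j l =
     (if j = 1 then axis (ix 1 l) 1 else axis (ix j l) 1 - axis (ix (j - 1) l) 1)"

text \<open>Sums of sets are Minkowski sums.\<close>

definition sum_polytope :: "'i set \<Rightarrow> ('i \<Rightarrow> 'a::euclidean_space set) \<Rightarrow> 'a set" where
  "sum_polytope I A = (\<Sum>i\<in>I. convex hull (A i))"

definition lifted_polytope ::
  "'i set \<Rightarrow> ('i \<Rightarrow> 'a::euclidean_space set) \<Rightarrow> ('i \<Rightarrow> 'a \<Rightarrow> real) \<Rightarrow> ('a \<times> real) set" where
  "lifted_polytope I A \<theta> = (\<Sum>i\<in>I. convex hull ((\<lambda>a. (a, \<theta> i a)) ` A i))"

text \<open>
  A lower face is a nonempty face, of any dimension, cut out by a supporting hyperplane whose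
  inner normal has positive last coordinate; that coordinate is normalised to 1.
\<close>

definition lower_face :: "('a::euclidean_space \<times> real) set \<Rightarrow> ('a \<times> real) set \<Rightarrow> bool" where
  "lower_face F P \<longleftrightarrow> F \<noteq> {} \<and>
     (\<exists>\<xi> c. (\<forall>p\<in>P. c \<le> (\<xi>, 1) \<bullet> p) \<and> F = {p \<in> P. (\<xi>, 1) \<bullet> p = c})"

definition mixed_subdivision ::
  "'i set \<Rightarrow> ('i \<Rightarrow> 'a::euclidean_space set) \<Rightarrow> ('i \<Rightarrow> 'a \<Rightarrow> real) \<Rightarrow> 'a set set" where
  "mixed_subdivision I A \<theta> = {fst ` F | F. lower_face F (lifted_polytope I A \<theta>)}"

text \<open>
  Intersection of a polyhedral complex with a polytope, as a polyhedral complex. The polytope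
  enters with all of its faces (\<open>P\<close> itself is one of them): the sets \<open>C \<inter> P\<close> alone are not
  closed under passing to faces. For example, the two legs of a right triangle at the corner of
  a square grid are intersections of grid cells with the triangle, its hypotenuse is not.
\<close>

definition restrict_complex :: "'a::euclidean_space set set \<Rightarrow> 'a set \<Rightarrow> 'a set set" where
  "restrict_complex S P = {C \<inter> F | C F. C \<in> S \<and> F face_of P \<and> C \<inter> F \<noteq> {}}"

end

theory Submission
  imports Defs
begin

text \<open>
  In the coordinates \<open>c\<^sub>j\<^sub>,\<^sub>l = \<Sum>J\<ge>j. b\<^sub>J\<^sub>,\<^sub>l\<close> the box polytopes are products of intervals
  \<open>[0, d\<^sub>i\<^sub>,\<^sub>l]\<close>, the simplices are cut out of them by \<open>c\<^sub>1\<^sub>,\<^sub>l \<ge> c\<^sub>2\<^sub>,\<^sub>l \<ge> \<dots>\<close>, and \<open>v\<close> has negative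
  coefficients \<open>\<langle>v, w\<^sub>j\<^sub>,\<^sub>l\<rangle>\<close>. A lowest lift of a point of the big Minkowski sum is therefore obtained
  in each coordinate separately, by filling up the summands greedily in the order of decreasing
  \<open>\<lambda>\<^sub>i\<close>. Greedy filling is monotone, so it preserves the order of the \<open>c\<^sub>j\<^sub>,\<^sub>l\<close>: over \<open>\<Delta>\<close> the lowest
  lift already lies in the lifted sum of simplices, and the two lower hulls agree there. The rest
  is convex geometry: the faces of an intersection of two polytopes are the intersections of
  their faces.
\<close>

subsection \<open>Lower faces over a subpolytope\<close>

text \<open>The smallest face through \<open>z\<close> works: the relative interior of a polyhedron
  is what its facets leave over, and a facet through \<open>z\<close> would be a smaller
  face.\<close>

lemma polytope_face_with_point_in_rel_interior:
  fixes S :: "'a::euclidean_space set"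
  assumes "polytope S" "z \<in> S"
  obtains G where "G face_of S" "z \<in> rel_interior G"
proof -
  let ?\<F> = "{G. G face_of S \<and> z \<in> G}"
  have "finite ?\<F>"
    using finite_polytope_faces[OF assms(1)] by (rule finite_subset[rotated]) auto
  moreover have "S \<in> ?\<F>"
    using assms by (simp add: face_of_refl polytope_imp_convex)
  ultimately obtain G where G: "G \<in> ?\<F>" and min: "\<And>H. H \<in> ?\<F> \<Longrightarrow> H \<subseteq> G \<Longrightarrow> G = H"
    using finite_has_minimal[of ?\<F>] by blast
  have "polyhedron G"
    using G assms(1) face_of_polytope_polytope polytope_imp_polyhedron by blast
  moreover have "z \<notin> \<Union>{F. F facet_of G}"
  proof
    assume "z \<in> \<Union>{F. F facet_of G}"
    then obtain F where F: "F facet_of G" "z \<in> F" by blast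
    then have "F \<in> ?\<F>" "F \<subseteq> G"
      using G facet_of_imp_face_of face_of_trans facet_of_imp_subset by blast+
    then show False
      using min F(1) by force
  qed
  ultimately have "z \<in> rel_interior G"
    using G by (simp add: rel_interior_of_polyhedron)
  then show thesis
    using that G by blast
qed

lemma lower_faceE:
  assumes "lower_face F P"
  obtains \<xi> c where "F \<noteq> {}" "\<And>x t. (x, t) \<in> P \<Longrightarrow> c \<le> \<xi> \<bullet> x + t"
    "\<And>x t. (x, t) \<in> F \<longleftrightarrow> (x, t) \<in> P \<and> \<xi> \<bullet> x + t = c"
proof -
  obtain \<xi> c where "F \<noteq> {}" "\<forall>p\<in>P. c \<le> (\<xi>, 1) \<bullet> p" "F = {p \<in> P. (\<xi>, 1) \<bullet> p = c}"
    using assms unfolding lower_face_def by blast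
  then show thesis
    by (intro that[of c \<xi>]) (auto simp: inner_Pair)
qed

lemma lower_faceI:
  assumes "F \<noteq> {}" "\<And>x t. (x, t) \<in> P \<Longrightarrow> c \<le> \<xi> \<bullet> x + t"
    "\<And>x t. (x, t) \<in> F \<longleftrightarrow> (x, t) \<in> P \<and> \<xi> \<bullet> x + t = c"
  shows "lower_face F P"
  unfolding lower_face_def
proof (intro conjI exI[of _ \<xi>] exI[of _ c])
  show "\<forall>p\<in>P. c \<le> (\<xi>, 1) \<bullet> p" "F = {p \<in> P. (\<xi>, 1) \<bullet> p = c}"
    using assms(2,3) by (auto simp: inner_Pair)
qed fact

text \<open>Isolates the convex geometry: \<open>P\<close> is to be the lifted sum of simplices and
  \<open>P'\<close> that of the boxes. With \<open>P_subset\<close>, the condition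
  \<open>below\<close> makes the two lower hulls agree over the projection of
  \<open>P\<close>.\<close>

locale lower_hull_extension =
  fixes P P' :: "('a::euclidean_space \<times> real) set"
  assumes polytope_P: "polytope P" and polytope_P': "polytope P'"
    and P_subset: "P \<subseteq> P'"
    and below: "\<And>x t. (x, t) \<in> P' \<Longrightarrow> x \<in> fst ` P \<Longrightarrow> \<exists>t'\<le>t. (x, t') \<in> P"
begin

text \<open>Subtracting a linear form that exposes \<open>F\<close> from the functional that cuts
  out \<open>G\<close> gives a functional that is minimal on \<open>P\<close> exactly where both
  supporting inequalities are tight.\<close>

lemma lower_cell_Int_face:
  assumes G: "lower_face G P'" and F: "F face_of fst ` P" and ne: "fst ` G \<inter> F \<noteq> {}"
  shows "\<exists>H. lower_face H P \<and> fst ` H = fst ` G \<inter> F"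
proof -
  obtain \<xi> c where lb: "\<And>x t. (x, t) \<in> P' \<Longrightarrow> c \<le> \<xi> \<bullet> x + t"
    and G_iff: "\<And>x t. (x, t) \<in> G \<longleftrightarrow> (x, t) \<in> P' \<and> \<xi> \<bullet> x + t = c"
    using lower_faceE[OF G] by metis
  have "polyhedron (fst ` P)"
    by (intro polytope_imp_polyhedron polytope_linear_image linear_fst polytope_P)
  then have "F exposed_face_of fst ` P"
    using F by (simp add: exposed_face_of_polyhedron)
  then obtain a b where ab: "fst ` P \<subseteq> {x. a \<bullet> x \<le> b}" "F = fst ` P \<inter> {x. a \<bullet> x = b}"
    unfolding exposed_face_of_def by blast
  define H where "H = {p \<in> P. (\<xi> - a) \<bullet> fst p + snd p = c - b}"
  \<comment> \<open>The slack of the combined inequality is the sum of two nonnegative slacks, so it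
    vanishes only if both do.\<close>
  have H_iff: "(x, t) \<in> H \<longleftrightarrow> (x, t) \<in> P \<and> \<xi> \<bullet> x + t = c \<and> a \<bullet> x = b" for x t
  proof (cases "(x, t) \<in> P")
    case True
    then have "c \<le> \<xi> \<bullet> x + t" "a \<bullet> x \<le> b"
      using lb P_subset ab(1) by force+
    then show ?thesis
      using True by (auto simp: H_def inner_diff_left)
  qed (simp add: H_def)
  have "fst ` H = fst ` G \<inter> F"
  proof (intro equalityI subsetI)
    fix x assume "x \<in> fst ` H"
    then obtain t where "(x, t) \<in> H" by force
    then have "(x, t) \<in> G" "x \<in> F"
      using P_subset by (force simp: H_iff G_iff ab(2))+
    then show "x \<in> fst ` G \<inter> F" by force
  next
    fix x assume x: "x \<in> fst ` G \<inter> F"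
    then obtain t where "(x, t) \<in> G" by force
    then have t: "(x, t) \<in> P'" "\<xi> \<bullet> x + t = c"
      by (simp_all add: G_iff)
    moreover have "x \<in> fst ` P" "a \<bullet> x = b"
      using x ab(2) by blast+
    ultimately obtain t' where t': "t' \<le> t" "(x, t') \<in> P"
      using below by blast
    \<comment> \<open>The bound holds on \<open>P\<close> as well, and together with
      \<open>t' \<le> t\<close> it forces \<open>t' = t\<close>.\<close>
    then have "c \<le> \<xi> \<bullet> x + t'"
      using lb P_subset by blast
    then have "(x, t') \<in> H"
      using t t' \<open>a \<bullet> x = b\<close> by (simp add: H_iff)
    then show "x \<in> fst ` H" by force
  qed
  moreover have "lower_face H P"
  proof (rule lower_faceI[where \<xi> = "\<xi> - a" and c = "c - b"])
    show "H \<noteq> {}"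
      using ne calculation by blast
    show "c - b \<le> (\<xi> - a) \<bullet> x + t" if "(x, t) \<in> P" for x t
    proof -
      have "c \<le> \<xi> \<bullet> x + t" "a \<bullet> x \<le> b"
        using lb P_subset ab(1) that by force+
      then show ?thesis by (simp add: inner_diff_left)
    qed
  qed (simp add: H_def)
  ultimately show ?thesis by blast
qed

text \<open>
  The set \<open>E\<close> thickens \<open>P'\<close> upwards: a face of \<open>E\<close> that meets \<open>P'\<close> has an inner normal with last
  coordinate at least 0, and if this is 0 the face contains vertical segments, which a lower face
  does not. The face \<open>G\<close> of \<open>E\<close> and the face \<open>F2\<close> of the projection are chosen to have a relative
  interior point of \<open>F\<close> (respectively its projection) in their relative interior, so that a segment
  from a common point can be prolonged beyond it inside both sets.
\<close>

lemma lower_cell_eq_Int_face: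
  assumes "lower_face F P"
  shows "\<exists>G F2. lower_face G P' \<and> F2 face_of fst ` P \<and> fst ` F = fst ` G \<inter> F2"
proof -
  obtain \<xi> c where "F \<noteq> {}" and lb: "\<And>x t. (x, t) \<in> P \<Longrightarrow> c \<le> \<xi> \<bullet> x + t"
    and F_iff: "\<And>x t. (x, t) \<in> F \<longleftrightarrow> (x, t) \<in> P \<and> \<xi> \<bullet> x + t = c"
    using lower_faceE[OF assms] by metis
  define E where "E = P' + closed_segment 0 (0, 1)"
  have E_iff: "(x, t) \<in> E \<longleftrightarrow> (\<exists>r. 0 \<le> r \<and> r \<le> 1 \<and> (x, t - r) \<in> P')" for x t
    by (force simp: E_def set_plus_def closed_segment_def)
  have "polytope E"
  proof -
    obtain V where "finite V" "P' = convex hull V"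
      using polytope_P' polytope_def by blast
    then have "E = convex hull (V + {0, (0, 1)})"
      by (simp add: E_def convex_hull_set_plus segment_convex_hull)
    then show ?thesis
      using \<open>finite V\<close> by (simp add: polytope_convex_hull finite_set_plus)
  qed
  have E_below: "\<exists>t'\<le>t. (x, t') \<in> P" if xt: "(x, t) \<in> E" "x \<in> fst ` P" for x t
  proof -
    obtain r where "0 \<le> r" "(x, t - r) \<in> P'"
      using xt E_iff by blast
    then obtain t' where "t' \<le> t - r" "(x, t') \<in> P"
      using below xt(2) by blast
    then show ?thesis
      using \<open>0 \<le> r\<close> by (intro exI[of _ t']) auto
  qed
  have E_lb: "c \<le> \<xi> \<bullet> x + t" if "(x, t) \<in> E" "x \<in> fst ` P" for x t
    using E_below[OF that] lb by (meson add_left_mono order_trans)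
  \<comment> \<open>Over the projection of \<open>P\<close>, neither \<open>P'\<close> nor the
    thickening adds points where the functional takes the value \<open>c\<close>.\<close>
  have E_F: "(x, t) \<in> F" if xt: "(x, t) \<in> E" "x \<in> fst ` P" "\<xi> \<bullet> x + t = c" for x t
  proof -
    obtain t' where t': "t' \<le> t" "(x, t') \<in> P"
      using E_below xt by blast
    then show ?thesis
      using lb[OF t'(2)] xt(3) by (auto simp: F_iff)
  qed
  have "P' \<subseteq> E"
    using E_iff by (force intro: exI[of _ 0])
  have "F \<subseteq> P"
    using F_iff by auto
  have "convex F"
  proof -
    have "F = P \<inter> {p. (\<xi>, 1) \<bullet> p = c}"
      using F_iff by (auto simp: inner_Pair)
    then show ?thesis
      by (simp add: convex_Int convex_hyperplane polytope_imp_convex polytope_P)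
  qed
  then have "rel_interior F \<noteq> {}"
    using \<open>F \<noteq> {}\<close> by (simp add: rel_interior_eq_empty)
  then obtain z where z: "z \<in> rel_interior F" by blast
  obtain x0 t0 where z_eq: "z = (x0, t0)" by (cases z)
  have zF: "(x0, t0) \<in> F"
    using z z_eq rel_interior_subset by blast
  then have x0: "x0 \<in> fst ` P" and zP: "(x0, t0) \<in> P" and zc: "\<xi> \<bullet> x0 + t0 = c"
    by (auto simp: F_iff intro: rev_image_eqI)
  have "polytope (fst ` P)"
    by (intro polytope_linear_image linear_fst polytope_P)
  have "z \<in> E"
    using zP z_eq P_subset \<open>P' \<subseteq> E\<close> by blast
  then obtain G where G: "G face_of E" "z \<in> rel_interior G"
    using polytope_face_with_point_in_rel_interior[OF \<open>polytope E\<close>] by blast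
  obtain F2 where F2: "F2 face_of fst ` P" "x0 \<in> rel_interior F2"
    using polytope_face_with_point_in_rel_interior[OF \<open>polytope (fst ` P)\<close> x0] by blast
  \<comment> \<open>A face that meets the relative interior of a convex subset contains this subset;
    the same argument puts the projection of \<open>F\<close> into \<open>F2\<close>.\<close>
  have "F \<subseteq> G"
    using subset_of_face_of[OF G(1)] z G(2) \<open>F \<subseteq> P\<close> P_subset \<open>P' \<subseteq> E\<close> rel_interior_subset
    by (metis Int_iff empty_iff order_trans subsetD)
  have "x0 \<in> rel_interior (fst ` F)"
    using rel_interior_convex_linear_image[OF linear_fst \<open>convex F\<close>] z z_eq by force
  then have "fst ` F \<subseteq> F2"
    using subset_of_face_of[OF F2(1)] F2(2) \<open>F \<subseteq> P\<close> rel_interior_subset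
    by (metis Int_iff empty_iff image_mono subsetD)
  \<comment> \<open>On the segment from \<open>p\<close> prolonged beyond \<open>z\<close> the
    functional is affine, at least \<open>c\<close>, and equal to \<open>c\<close> at the inner
    point \<open>z\<close>; hence it equals \<open>c\<close> at \<open>p\<close>.\<close>
  have GF2: "p \<in> F" if p: "p \<in> G" "fst p \<in> F2" for p
  proof -
    obtain x t where p_eq: "p = (x, t)" by (cases p)
    have xt: "(x, t) \<in> E" "x \<in> fst ` P"
      using p p_eq G(1) F2(1) face_of_imp_subset by force+
    have "convex G" "convex F2"
      using G(1) F2(1) face_of_imp_convex by blast+
    obtain e1 where e1: "e1 > 1" "(1 - e1) *\<^sub>R (x, t) + e1 *\<^sub>R z \<in> G"
      using G(2) p p_eq convex_rel_interior_iff[OF \<open>convex G\<close>] by blast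
    obtain e2 where e2: "e2 > 1" "(1 - e2) *\<^sub>R x + e2 *\<^sub>R x0 \<in> F2"
      using F2(2) p p_eq convex_rel_interior_iff[OF \<open>convex F2\<close>] by fastforce
    \<comment> \<open>One factor has to serve both \<open>G\<close> and \<open>F2\<close>;
      \<open>shrink\<close> shortens the longer prolongation by convexity.\<close>
    define e where "e = min e1 e2"
    have "e > 1" using e1 e2 by (simp add: e_def)
    have shrink: "(1 - e) *\<^sub>R u + e *\<^sub>R w \<in> S"
      if "convex S" "u \<in> S" "e' > 1" "e \<le> e'" "(1 - e') *\<^sub>R u + e' *\<^sub>R w \<in> S"
      for S :: "'b::real_vector set" and u w e'
    proof -
      have "(1 - e / e') *\<^sub>R u + (e / e') *\<^sub>R ((1 - e') *\<^sub>R u + e' *\<^sub>R w) \<in> S"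
        using that \<open>e > 1\<close> by (intro convexD_alt[OF \<open>convex S\<close> that(2) that(5)]) auto
      moreover have "(1 - e / e') *\<^sub>R u + (e / e') *\<^sub>R ((1 - e') *\<^sub>R u + e' *\<^sub>R w)
          = ((1 - e / e') + e / e' * (1 - e')) *\<^sub>R u + (e / e' * e') *\<^sub>R w"
        by (simp only: scaleR_add_left scaleR_add_right scaleR_scaleR add.assoc)
      moreover have "(1 - e / e') + e / e' * (1 - e') = 1 - e" "e / e' * e' = e"
        using that(3) by (simp_all add: field_simps)
      ultimately show ?thesis by metis
    qed
    have "(1 - e) *\<^sub>R (x, t) + e *\<^sub>R z \<in> E"
      using shrink[OF \<open>convex G\<close> _ e1(1) _ e1(2)] p p_eq G(1) face_of_imp_subset
      by (force simp: e_def)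
    then have "((1 - e) *\<^sub>R x + e *\<^sub>R x0, (1 - e) * t + e * t0) \<in> E"
      by (simp add: z_eq)
    moreover have "(1 - e) *\<^sub>R x + e *\<^sub>R x0 \<in> fst ` P"
      using shrink[OF \<open>convex F2\<close> _ e2(1) _ e2(2)] p p_eq F2(1) face_of_imp_subset
      by (force simp: e_def)
    ultimately have "c \<le> \<xi> \<bullet> ((1 - e) *\<^sub>R x + e *\<^sub>R x0) + ((1 - e) * t + e * t0)"
      by (rule E_lb)
    also have "\<dots> = (1 - e) * (\<xi> \<bullet> x + t) + e * (\<xi> \<bullet> x0 + t0)"
      by (simp add: inner_add_right algebra_simps)
    also have "\<dots> = (1 - e) * (\<xi> \<bullet> x + t - c) + c"
      unfolding zc by (simp add: algebra_simps)
    finally have "0 \<le> (1 - e) * (\<xi> \<bullet> x + t - c)"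
      by simp
    then have "\<xi> \<bullet> x + t \<le> c"
      using \<open>e > 1\<close> by (simp add: zero_le_mult_iff)
    then show ?thesis
      using E_lb[OF xt] E_F[OF xt] p_eq by simp
  qed
  have "G exposed_face_of E"
    using G(1) \<open>polytope E\<close> by (simp add: exposed_face_of_polyhedron polytope_imp_polyhedron)
  then obtain a b where ab: "E \<subseteq> {p. a \<bullet> p \<le> b}" "G = E \<inter> {p. a \<bullet> p = b}"
    unfolding exposed_face_of_def by blast
  obtain \<alpha> \<tau> where a_eq: "a = (\<alpha>, \<tau>)" by (cases a)
  \<comment> \<open>\<open>a\<close> is an outer normal of \<open>E\<close>. The point one unit
    above \<open>z\<close> is still in \<open>E\<close> but, by \<open>GF2\<close>, outside
    \<open>G\<close>, so the form \<open>a\<close> strictly decreases upwards.\<close>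
  have "\<tau> < 0"
  proof -
    have "(x0, t0 + 1) \<in> E"
      using zP P_subset by (force simp: E_iff intro: exI[of _ 1])
    moreover have "(x0, t0 + 1) \<notin> F"
      using zc by (simp add: F_iff)
    then have "(x0, t0 + 1) \<notin> G"
      using GF2 F2(2) rel_interior_subset by fastforce
    ultimately have "a \<bullet> (x0, t0 + 1) \<noteq> b" "a \<bullet> (x0, t0 + 1) \<le> b"
      using ab by blast+
    moreover have "a \<bullet> (x0, t0) = b"
      using ab(2) zF \<open>F \<subseteq> G\<close> by blast
    ultimately show ?thesis
      by (simp add: a_eq inner_Pair algebra_simps)
  qed
  have normalised: "(\<alpha> /\<^sub>R \<tau>) \<bullet> x + t = (a \<bullet> (x, t)) / \<tau>" for x t
    using \<open>\<tau> < 0\<close> by (simp add: a_eq inner_Pair field_simps)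
  define G' where "G' = G \<inter> P'"
  have "lower_face G' P'"
  proof (rule lower_faceI[where \<xi> = "\<alpha> /\<^sub>R \<tau>" and c = "b / \<tau>"])
    show "G' \<noteq> {}"
      using zF zP \<open>F \<subseteq> G\<close> P_subset by (auto simp: G'_def)
    show "b / \<tau> \<le> (\<alpha> /\<^sub>R \<tau>) \<bullet> x + t" if "(x, t) \<in> P'" for x t
      using that ab(1) \<open>P' \<subseteq> E\<close> \<open>\<tau> < 0\<close> unfolding normalised
      by (intro divide_right_mono_neg) auto
    show "(x, t) \<in> G' \<longleftrightarrow> (x, t) \<in> P' \<and> (\<alpha> /\<^sub>R \<tau>) \<bullet> x + t = b / \<tau>" for x t
      using \<open>P' \<subseteq> E\<close> \<open>\<tau> < 0\<close> unfolding normalised by (auto simp: G'_def ab(2))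
  qed
  moreover have "fst ` F = fst ` G' \<inter> F2"
  proof (intro equalityI subsetI)
    fix x assume "x \<in> fst ` F"
    moreover have "F \<subseteq> G'"
      using \<open>F \<subseteq> G\<close> \<open>F \<subseteq> P\<close> P_subset by (auto simp: G'_def)
    ultimately show "x \<in> fst ` G' \<inter> F2"
      using \<open>fst ` F \<subseteq> F2\<close> by blast
  next
    fix x assume "x \<in> fst ` G' \<inter> F2"
    then obtain p where "p \<in> G" "fst p = x" "x \<in> F2"
      by (auto simp: G'_def)
    then show "x \<in> fst ` F"
      using GF2[of p] by blast
  qed
  ultimately show ?thesis
    using F2(1) by blast
qed

text \<open>The two preceding lemmas give the two inclusions of the first claim. The other claims
  come from taking \<open>\<Delta>\<close> as a face of itself.\<close>

lemma lower_cells_eq_restrict_complex: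
  defines "S \<equiv> {fst ` F | F. lower_face F P}"
    and "S' \<equiv> {fst ` F | F. lower_face F P'}"
    and "\<Delta> \<equiv> fst ` P"
  shows "S = restrict_complex S' \<Delta>"
    and "C \<in> S' \<Longrightarrow> C \<inter> \<Delta> \<noteq> {} \<Longrightarrow> C \<inter> \<Delta> \<in> S"
    and "{C \<in> S. interior C \<noteq> {}} = {C \<inter> \<Delta> | C. C \<in> S' \<and> interior (C \<inter> \<Delta>) \<noteq> {}}"
proof -
  have ne: "C \<noteq> {}" if "C \<in> S" for C
    using that by (auto simp: S_def lower_face_def)
  have fwd: "\<exists>C' F. C' \<in> S' \<and> F face_of \<Delta> \<and> C = C' \<inter> F" if C: "C \<in> S" for C
  proof -
    obtain F where F: "lower_face F P" "C = fst ` F"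
      using C S_def by blast
    then show ?thesis
      using lower_cell_eq_Int_face[OF F(1)] unfolding S'_def \<Delta>_def by blast
  qed
  have bwd: "C \<inter> F \<in> S" if C: "C \<in> S'" and F: "F face_of \<Delta>" "C \<inter> F \<noteq> {}" for C F
  proof -
    obtain G where "lower_face G P'" "C = fst ` G"
      using C S'_def by blast
    then show ?thesis
      using lower_cell_Int_face[of G F] F
      unfolding S_def \<Delta>_def by (metis (mono_tags, lifting) mem_Collect_eq)
  qed
  show "S = restrict_complex S' \<Delta>"
  proof (intro equalityI subsetI)
    fix C assume "C \<in> S"
    then show "C \<in> restrict_complex S' \<Delta>"
      using fwd[of C] ne[of C] unfolding restrict_complex_def by blast
  next
    fix C assume "C \<in> restrict_complex S' \<Delta>"
    then show "C \<in> S"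
      using bwd unfolding restrict_complex_def by blast
  qed
  have "\<Delta> face_of \<Delta>"
    by (simp add: \<Delta>_def face_of_refl polytope_imp_convex polytope_P polytope_linear_image linear_fst)
  then show \<Delta>: "C \<inter> \<Delta> \<in> S" if "C \<in> S'" "C \<inter> \<Delta> \<noteq> {}" for C
    using bwd that by blast
  show "{C \<in> S. interior C \<noteq> {}} = {C \<inter> \<Delta> | C. C \<in> S' \<and> interior (C \<inter> \<Delta>) \<noteq> {}}"
  proof (intro equalityI subsetI)
    fix C assume C: "C \<in> {C \<in> S. interior C \<noteq> {}}"
    then obtain C' F where CF: "C' \<in> S'" "F face_of \<Delta>" "C = C' \<inter> F"
      using fwd by blast
    have "F \<subseteq> \<Delta>"
      using CF(2) by (rule face_of_imp_subset)
    then have "interior F \<noteq> {}" "interior F \<subseteq> interior \<Delta>"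
      using C CF(3) interior_mono by auto
    \<comment> \<open>A proper face is disjoint from the interior, so a cell with interior can only
      be cut out by \<open>\<Delta>\<close> itself.\<close>
    then have "F = \<Delta>"
      using face_of_disjoint_interior[OF CF(2)] interior_subset[of F] by blast
    then show "C \<in> {C \<inter> \<Delta> | C. C \<in> S' \<and> interior (C \<inter> \<Delta>) \<noteq> {}}"
      using C CF by blast
  next
    fix C assume "C \<in> {C \<inter> \<Delta> | C. C \<in> S' \<and> interior (C \<inter> \<Delta>) \<noteq> {}}"
    then obtain C' where C': "C = C' \<inter> \<Delta>" "C' \<in> S'" "interior (C' \<inter> \<Delta>) \<noteq> {}"
      by blast
    then have "C' \<inter> \<Delta> \<noteq> {}" by force
    with C' \<Delta> show "C \<in> {C \<in> S. interior C \<noteq> {}}"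
      by blast
  qed
qed

end

subsection \<open>Greedy filling\<close>

text \<open>Abel summation: the partial sums of \<open>g - c\<close> are nonnegative and the weights
  do not increase. At \<open>m = N\<close> the left side of the inductive bound vanishes by
  \<open>total\<close>.\<close>

lemma sum_Abel_le:
  fixes lam g c :: "nat \<Rightarrow> real"
  assumes anti: "\<And>i. i < N \<Longrightarrow> lam (Suc i) \<le> lam i"
    and partial: "\<And>m. m < N \<Longrightarrow> (\<Sum>i\<le>m. c i) \<le> (\<Sum>i\<le>m. g i)"
    and total: "(\<Sum>i\<le>N. c i) = (\<Sum>i\<le>N. g i)"
  shows "(\<Sum>i\<le>N. lam i * c i) \<le> (\<Sum>i\<le>N. lam i * g i)"
proof -
  have "m \<le> N \<Longrightarrow> lam m * (\<Sum>i\<le>m. g i - c i) \<le> (\<Sum>i\<le>m. lam i * (g i - c i))" for m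
  proof (induction m)
    case (Suc m)
    then have "0 \<le> (\<Sum>i\<le>m. g i - c i)"
      using partial[of m] by (simp add: sum_subtractf)
    then have "lam (Suc m) * (\<Sum>i\<le>m. g i - c i) \<le> lam m * (\<Sum>i\<le>m. g i - c i)"
      using anti Suc.prems by (intro mult_right_mono) auto
    with Suc show ?case
      by (simp add: distrib_left)
  qed simp
  from this[of N] total show ?thesis
    by (simp add: sum_subtractf right_diff_distrib)
qed

text \<open>The share of vessel \<open>i\<close> when the amount \<open>c\<close> is poured into
  vessels of capacities \<open>\<delta> 0\<close>, \<open>\<delta> 1\<close>, ... in this order.
  Written as a difference of truncated prefix capacities, it telescopes under summation.\<close>

definition greedy :: "(nat \<Rightarrow> real) \<Rightarrow> nat \<Rightarrow> real \<Rightarrow> real" where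
  "greedy \<delta> i c = min c (\<Sum>i'\<le>i. \<delta> i') - min c (\<Sum>i'<i. \<delta> i')"

lemma sum_greedy:
  assumes "0 \<le> c"
  shows "(\<Sum>i\<le>m. greedy \<delta> i c) = min c (\<Sum>i\<le>m. \<delta> i)"
proof (induction m)
  case 0
  then show ?case using assms by (simp add: greedy_def)
next
  case (Suc m)
  then show ?case by (simp add: greedy_def lessThan_Suc_atMost)
qed

text \<open>The share is \<open>c\<close> minus the capacity of the earlier vessels, clamped to the
  interval from 0 to \<open>\<delta> i\<close>.\<close>

lemma greedy_mono:
  assumes "0 \<le> \<delta> i" "c \<le> c'"
  shows "greedy \<delta> i c \<le> greedy \<delta> i c'"
proof -
  have "(\<Sum>i'\<le>i. \<delta> i') = (\<Sum>i'<i. \<delta> i') + \<delta> i"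
    by (simp add: lessThan_Suc_atMost[symmetric])
  then show ?thesis
    using assms by (auto simp: greedy_def min_def)
qed

lemma greedy_le: "0 \<le> \<delta> i \<Longrightarrow> greedy \<delta> i c \<le> \<delta> i"
  by (auto simp: greedy_def min_def lessThan_Suc_atMost[symmetric])

lemma greedy_0: "(\<And>i. 0 \<le> \<delta> i) \<Longrightarrow> greedy \<delta> i 0 = 0"
  by (simp add: greedy_def min_def sum_nonneg)

text \<open>Any admissible filling has partial sums bounded by both the total and the prefix
  capacity; greedy filling attains the minimum of these two bounds, so \<open>sum_Abel_le\<close>
  applies.\<close>

lemma sum_greedy_optimal:
  assumes anti: "\<And>i. i < N \<Longrightarrow> lam (Suc i) \<le> lam i"
    and c: "\<And>i. i \<le> N \<Longrightarrow> 0 \<le> c i \<and> c i \<le> \<delta> i"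
  shows "(\<Sum>i\<le>N. lam i * c i) \<le> (\<Sum>i\<le>N. lam i * greedy \<delta> i (\<Sum>i\<le>N. c i))"
proof -
  have le_total: "(\<Sum>i\<le>m. c i) \<le> (\<Sum>i\<le>N. c i)" if "m \<le> N" for m
    using that c by (intro sum_mono2) auto
  have le_cap: "(\<Sum>i\<le>m. c i) \<le> (\<Sum>i\<le>m. \<delta> i)" if "m \<le> N" for m
    using that c by (intro sum_mono) auto
  have "0 \<le> (\<Sum>i\<le>N. c i)"
    using c by (intro sum_nonneg) auto
  then show ?thesis
    using anti le_total le_cap by (intro sum_Abel_le) (simp_all add: sum_greedy)
qed

lemma sum_backward_diff:
  fixes a :: "nat \<Rightarrow> real"
  shows "(\<Sum>j=1..Suc m. a j - (if j = 1 then 0 else a (j - 1))) = a (Suc m)"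
  by (induction m) auto

text \<open>Summation by parts. The first difference is taken against 0 instead of
  \<open>a 0\<close>, in accordance with the case \<open>j = 1\<close> of
  \<open>w_vec\<close>.\<close>

lemma sum_mult_eq_sum_tails:
  fixes a b :: "nat \<Rightarrow> real"
  shows "(\<Sum>j=1..m. a j * b j) =
    (\<Sum>j=1..m. (a j - (if j = 1 then 0 else a (j - 1))) * (\<Sum>J=j..m. b J))"
proof (induction m)
  case (Suc m)
  let ?u = "\<lambda>j. a j - (if j = 1 then 0 else a (j - 1))"
  have "(\<Sum>j=1..Suc m. ?u j * (\<Sum>J=j..Suc m. b J))
      = (\<Sum>j=1..Suc m. ?u j * (\<Sum>J=j..m. b J) + ?u j * b (Suc m))"
    by (intro sum.cong refl) (auto simp: distrib_left)
  also have "\<dots> = (\<Sum>j=1..m. ?u j * (\<Sum>J=j..m. b J)) + a (Suc m) * b (Suc m)"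
    unfolding sum.distrib sum_distrib_right[symmetric] sum_backward_diff by simp
  finally show ?case
    using Suc by simp
qed simp

subsection \<open>Lifted Minkowski sums in block coordinates\<close>

lemma finite_vec_components:
  assumes "finite B"
  shows "finite {b :: 'b ^ 'k::finite. \<forall>k. b $ k \<in> B}"
proof (rule finite_subset)
  show "{b :: 'b ^ 'k. \<forall>k. b $ k \<in> B} \<subseteq> (\<lambda>f. \<chi> k. f k) ` (UNIV \<rightarrow>\<^sub>E B)"
  proof
    fix b :: "'b ^ 'k" assume "b \<in> {b. \<forall>k. b $ k \<in> B}"
    then show "b \<in> (\<lambda>f. \<chi> k. f k) ` (UNIV \<rightarrow>\<^sub>E B)"
      by (intro rev_image_eqI[of "\<lambda>k. b $ k"]) (auto simp: PiE_iff)
  qed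
qed (simp add: assms finite_PiE)

text \<open>For a linear lifting, the hull of the lifted points is the graph over the hull. Points
  of the lifted sum are therefore decompositions of \<open>x\<close> together with their total
  height.\<close>

lemma lifted_polytope_linear_iff:
  assumes "finite I"
  shows "(x, t) \<in> lifted_polytope I A (\<lambda>i x. lam i * (v \<bullet> x)) \<longleftrightarrow>
    (\<exists>y. (\<forall>i\<in>I. y i \<in> convex hull (A i)) \<and> x = (\<Sum>i\<in>I. y i) \<and> t = (\<Sum>i\<in>I. lam i * (v \<bullet> y i)))"
    (is "?lhs \<longleftrightarrow> ?rhs")
proof -
  have "linear (\<lambda>a. (a, lam i * (v \<bullet> a)))" for i
    by (intro linearI) (auto simp: inner_add_right algebra_simps)
  then have hull: "convex hull ((\<lambda>a. (a, lam i * (v \<bullet> a))) ` A i)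
      = (\<lambda>a. (a, lam i * (v \<bullet> a))) ` (convex hull (A i))" for i
    by (simp add: convex_hull_linear_image)
  have pair_sum: "(\<Sum>i\<in>I. (y i, lam i * (v \<bullet> y i))) = (\<Sum>i\<in>I. y i, \<Sum>i\<in>I. lam i * (v \<bullet> y i))" for y
    by (simp add: prod_eq_iff fst_sum snd_sum)
  have "?lhs \<longleftrightarrow> (\<exists>p. (\<forall>i\<in>I. p i \<in> (\<lambda>a. (a, lam i * (v \<bullet> a))) ` (convex hull (A i))) \<and> (x, t) = sum p I)"
    unfolding lifted_polytope_def hull set_sum_alt[OF assms] by blast
  also have "\<dots> \<longleftrightarrow> ?rhs"
  proof
    assume "\<exists>p. (\<forall>i\<in>I. p i \<in> (\<lambda>a. (a, lam i * (v \<bullet> a))) ` (convex hull (A i))) \<and> (x, t) = sum p I"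
    then obtain p where p: "\<forall>i\<in>I. p i \<in> (\<lambda>a. (a, lam i * (v \<bullet> a))) ` (convex hull (A i))"
      and xt: "(x, t) = sum p I" by blast
    have "p i = (fst (p i), lam i * (v \<bullet> fst (p i)))" "fst (p i) \<in> convex hull (A i)" if "i \<in> I" for i
      using p that by force+
    then have "sum p I = (\<Sum>i\<in>I. (fst (p i), lam i * (v \<bullet> fst (p i))))"
      by (intro sum.cong refl)
    then show ?rhs
      using xt pair_sum \<open>\<And>i. i \<in> I \<Longrightarrow> fst (p i) \<in> convex hull (A i)\<close>
      by (intro exI[of _ "\<lambda>i. fst (p i)"]) simp
  next
    assume ?rhs
    then obtain y where "\<forall>i\<in>I. y i \<in> convex hull (A i)" "x = (\<Sum>i\<in>I. y i)"
      "t = (\<Sum>i\<in>I. lam i * (v \<bullet> y i))" by blast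
    then show "\<exists>p. (\<forall>i\<in>I. p i \<in> (\<lambda>a. (a, lam i * (v \<bullet> a))) ` (convex hull (A i))) \<and> (x, t) = sum p I"
      by (intro exI[of _ "\<lambda>i. (y i, lam i * (v \<bullet> y i))"]) (auto simp: pair_sum)
  qed
  finally show ?thesis .
qed

lemma polytope_lifted_polytope:
  assumes "\<And>i. i \<in> I \<Longrightarrow> finite (A i)"
  shows "polytope (lifted_polytope I A \<theta>)"
  unfolding lifted_polytope_def convex_hull_set_sum[symmetric]
  using assms by (intro polytope_convex_hull finite_set_sum) simp

lemma fst_lifted_polytope_linear:
  assumes "finite I"
  shows "fst ` lifted_polytope I A (\<lambda>i x. lam i * (v \<bullet> x)) = sum_polytope I A"
proof (intro equalityI subsetI)
  fix x assume "x \<in> fst ` lifted_polytope I A (\<lambda>i x. lam i * (v \<bullet> x))"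
  then obtain t where "(x, t) \<in> lifted_polytope I A (\<lambda>i x. lam i * (v \<bullet> x))"
    by force
  then show "x \<in> sum_polytope I A"
    unfolding lifted_polytope_linear_iff[OF assms] sum_polytope_def set_sum_alt[OF assms] by blast
next
  fix x assume "x \<in> sum_polytope I A"
  then obtain y where "\<forall>i\<in>I. y i \<in> convex hull (A i)" "x = (\<Sum>i\<in>I. y i)"
    unfolding sum_polytope_def set_sum_alt[OF assms] by blast
  then have "(x, \<Sum>i\<in>I. lam i * (v \<bullet> y i)) \<in> lifted_polytope I A (\<lambda>i x. lam i * (v \<bullet> x))"
    unfolding lifted_polytope_linear_iff[OF assms] by blast
  then show "x \<in> fst ` lifted_polytope I A (\<lambda>i x. lam i * (v \<bullet> x))"
    by force
qed

section \<open>Tail coordinates of the blocks\<close>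

locale block_coordinates =
  fixes ix :: "nat \<Rightarrow> nat \<Rightarrow> 'k::finite" and s :: nat and n :: "nat \<Rightarrow> nat"
  assumes bij: "bij_betw (\<lambda>(j, l). ix j l) (block_index s n) UNIV"
begin

text \<open>The coordinates in which the box polytopes are products of intervals. For
  \<open>j = Suc (n l)\<close> the sum is empty, which gives the boundary value 0.\<close>

abbreviation tail :: "nat \<Rightarrow> nat \<Rightarrow> real ^ 'k \<Rightarrow> real" where
  "tail j l b \<equiv> \<Sum>J=j..n l. b $ ix J l"

lemma ix_eq_iff:
  assumes "l \<in> {1..s}" "j \<in> {1..n l}" "l' \<in> {1..s}" "j' \<in> {1..n l'}"
  shows "ix j l = ix j' l' \<longleftrightarrow> j = j' \<and> l = l'"
proof -
  have "(j, l) \<in> block_index s n" "(j', l') \<in> block_index s n"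
    using assms by (auto simp: block_index_def)
  then show ?thesis
    using bij_betw_imp_inj_on[OF bij] unfolding inj_on_def by force
qed

lemma ix_cases:
  obtains j l where "l \<in> {1..s}" "j \<in> {1..n l}" "k = ix j l"
proof -
  have "k \<in> (\<lambda>(j, l). ix j l) ` block_index s n"
    using bij by (simp add: bij_betw_def)
  then show thesis
    using that by (auto simp: block_index_def)
qed

lemma sum_ix:
  "(\<Sum>k\<in>UNIV. f k) = (\<Sum>l=1..s. \<Sum>j=1..n l. f (ix j l))"
proof -
  have "(\<Sum>l=1..s. \<Sum>j=1..n l. f (ix j l)) = (\<Sum>(l, j)\<in>(SIGMA l:{1..s}. {1..n l}). f (ix j l))"
    by (simp add: sum.Sigma)
  also have "\<dots> = (\<Sum>(j, l)\<in>block_index s n. f (ix j l))"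
    by (rule sum.reindex_bij_witness[where i = prod.swap and j = prod.swap])
      (auto simp: block_index_def)
  also have "\<dots> = (\<Sum>k\<in>UNIV. f k)"
    using sum.reindex_bij_betw[OF bij, of f] by (simp add: case_prod_beta')
  finally show ?thesis by simp
qed

lemma vec_from_blocks:
  obtains b :: "real ^ 'k" where "\<And>j l. l \<in> {1..s} \<Longrightarrow> j \<in> {1..n l} \<Longrightarrow> b $ ix j l = f j l"
proof -
  define inv where "inv = the_inv_into (block_index s n) (\<lambda>(j, l). ix j l)"
  have "inv (ix j l) = (j, l)" if "l \<in> {1..s}" "j \<in> {1..n l}" for j l
    using the_inv_into_f_f[OF bij_betw_imp_inj_on[OF bij], of "(j, l)"] that
    by (simp add: inv_def block_index_def)
  then show thesis
    by (intro that[of "\<chi> k. case inv k of (j, l) \<Rightarrow> f j l"]) simp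
qed

lemma inner_w_vec:
  "v \<bullet> w_vec ix j l = v $ ix j l - (if j = 1 then 0 else v $ ix (j - 1) l)"
  by (simp add: w_vec_def inner_diff_right inner_axis)

text \<open>The vectors \<open>w_vec ix j l\<close> form the basis dual to the tails:
  \<open>b\<close> is the sum of the \<open>tail j l b *\<^sub>R w_vec ix j l\<close>.\<close>

lemma inner_eq_sum_tails:
  "v \<bullet> b = (\<Sum>l=1..s. \<Sum>j=1..n l. (v \<bullet> w_vec ix j l) * tail j l b)"
proof -
  have "v \<bullet> b = (\<Sum>l=1..s. \<Sum>j=1..n l. v $ ix j l * b $ ix j l)"
    by (simp add: inner_vec_def sum_ix)
  also have "\<dots> = (\<Sum>l=1..s. \<Sum>j=1..n l. (v \<bullet> w_vec ix j l) * tail j l b)"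
    unfolding inner_w_vec by (rule sum.cong[OF refl]) (rule sum_mult_eq_sum_tails)
  finally show ?thesis .
qed

lemma tail_rec:
  "j \<in> {1..n l} \<Longrightarrow> tail j l b = b $ ix j l + tail (Suc j) l b"
  by (simp add: sum.atLeast_Suc_atMost)

lemma linear_tail: "linear (tail j l)"
  by (intro linearI) (simp_all add: sum.distrib sum_distrib_left)

section \<open>Inequalities for the supports and their hulls\<close>

lemma finite_box_support: "finite (box_support ix s n \<delta>)"
proof -
  define M where "M = Max (\<delta> ` {1..s})"
  have "box_support ix s n \<delta> \<subseteq> {b. \<forall>k. b $ k \<in> {z \<in> \<int>. \<bar>z\<bar> \<le> real M}}"
  proof (rule subsetI, rule CollectI, rule allI)
    fix b k assume b: "b \<in> box_support ix s n \<delta>"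
    obtain j l where jl: "l \<in> {1..s}" "j \<in> {1..n l}" "k = ix j l"
      by (rule ix_cases)
    have "0 \<le> tail j l b" "tail j l b \<le> real (\<delta> l)"
      using b jl by (auto simp: box_support_def)
    \<comment> \<open>A component is a difference of consecutive tails, so bounds on both tails
      bound it; at the end of a block the second tail is empty.\<close>
    moreover have "0 \<le> tail (Suc j) l b \<and> tail (Suc j) l b \<le> real (\<delta> l)"
    proof (cases "Suc j \<le> n l")
      case True
      then show ?thesis
        using b jl by (auto simp: box_support_def)
    qed simp
    moreover have "tail j l b = b $ ix j l + tail (Suc j) l b"
      using jl(2) by (rule tail_rec)
    moreover have "\<delta> l \<le> M"
      using jl(1) by (simp add: M_def)
    ultimately have "\<bar>b $ k\<bar> \<le> real M"
      unfolding jl(3) by linarith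
    moreover have "b $ k \<in> \<int>"
      using b by (simp add: box_support_def lattice_points_def)
    ultimately show "b $ k \<in> {z \<in> \<int>. \<bar>z\<bar> \<le> real M}"
      by simp
  qed
  then show ?thesis
    by (rule finite_subset) (intro finite_vec_components finite_abs_int_segment)
qed

lemma simplex_support_subset_box_support:
  "simplex_support ix s n \<delta> \<subseteq> box_support ix s n \<delta>"
proof
  fix b assume b: "b \<in> simplex_support ix s n \<delta>"
  have "0 \<le> tail j l b \<and> tail j l b \<le> real (\<delta> l)" if "l \<in> {1..s}" "j \<in> {1..n l}" for j l
  proof
    show "0 \<le> tail j l b"
      using b that by (intro sum_nonneg) (auto simp: simplex_support_def)
    have "tail j l b \<le> tail 1 l b"
      using b that by (intro sum_mono2) (auto simp: simplex_support_def)
    also have "\<dots> \<le> real (\<delta> l)"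
      using b that by (simp add: simplex_support_def)
    finally show "tail j l b \<le> real (\<delta> l)" .
  qed
  then show "b \<in> box_support ix s n \<delta>"
    using b by (simp add: box_support_def simplex_support_def)
qed

text \<open>Tails are linear, so a slab that contains the support contains its hull.\<close>

lemma tail_hull_box_support:
  assumes "y \<in> convex hull box_support ix s n \<delta>" "l \<in> {1..s}" "j \<in> {1..n l}"
  shows "0 \<le> tail j l y" "tail j l y \<le> real (\<delta> l)"
proof -
  have "convex (tail j l -` {0..real (\<delta> l)})"
    by (intro convex_linear_vimage linear_tail) simp
  then have "convex hull box_support ix s n \<delta> \<subseteq> tail j l -` {0..real (\<delta> l)}"
    using assms(2,3) by (intro hull_minimal) (auto simp: box_support_def)
  then show "0 \<le> tail j l y" "tail j l y \<le> real (\<delta> l)"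
    using assms(1) by auto
qed

lemma component_hull_simplex_support:
  assumes "y \<in> convex hull simplex_support ix s n \<delta>" "l \<in> {1..s}" "j \<in> {1..n l}"
  shows "0 \<le> y $ ix j l"
proof -
  have "convex ((\<lambda>y :: real ^ 'k. y $ ix j l) -` {0..})"
    by (intro convex_linear_vimage linearI) simp_all
  then have "convex hull simplex_support ix s n \<delta> \<subseteq> (\<lambda>y. y $ ix j l) -` {0..}"
    using assms(2,3) by (intro hull_minimal) (auto simp: simplex_support_def)
  then show ?thesis
    using assms(1) by auto
qed

text \<open>The polytope is a product of one scaled simplex per block, that is, a Minkowski sum of
  simplices in complementary coordinate spaces. It suffices to treat each block and to take the hull
  of the sum of the vertex sets.\<close>

lemma hull_simplex_supportI:
  assumes pos: "\<And>l. l \<in> {1..s} \<Longrightarrow> 0 < \<delta> l"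
    and nonneg: "\<And>j l. l \<in> {1..s} \<Longrightarrow> j \<in> {1..n l} \<Longrightarrow> 0 \<le> z $ ix j l"
    and le: "\<And>l. l \<in> {1..s} \<Longrightarrow> tail 1 l z \<le> real (\<delta> l)"
  shows "z \<in> convex hull simplex_support ix s n \<delta>"
proof -
  define B where "B l = insert 0 ((\<lambda>j. axis (ix j l) (real (\<delta> l))) ` {1..n l})" for l
  define zb where "zb l = (\<Sum>j=1..n l. axis (ix j l) (z $ ix j l))" for l
  have "z = (\<Sum>l=1..s. zb l)"
  proof -
    have "z = (\<Sum>k\<in>UNIV. axis k (z $ k))"
      by (simp add: vec_eq_iff axis_def sum.delta if_distrib cong: if_cong)
    then show ?thesis
      by (simp add: zb_def sum_ix)
  qed
  moreover have "zb l \<in> convex hull B l" if l: "l \<in> {1..s}" for l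
  proof -
    define y where "y j = (if j = 0 then 0 else axis (ix j l) (real (\<delta> l)))" for j
    \<comment> \<open>Barycentric coordinates in block \<open>l\<close>; index 0 stands for the
      vertex 0 and receives the remaining weight.\<close>
    define u where "u j = (if j = 0 then 1 - tail 1 l z / \<delta> l else z $ ix j l / \<delta> l)" for j
    have split0: "(\<Sum>j=0..n l. f j) = f 0 + (\<Sum>j=1..n l. f j)" for f :: "nat \<Rightarrow> 'b::comm_monoid_add"
      by (simp add: sum.atLeast_Suc_atMost)
    have "(\<Sum>j=0..n l. u j *\<^sub>R y j) \<in> convex hull B l"
    proof (rule convex_sum)
      have "(\<Sum>j=1..n l. u j) = tail 1 l z / \<delta> l"
        by (simp add: u_def sum_divide_distrib)
      then show "(\<Sum>j=0..n l. u j) = 1"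
        by (simp add: split0 u_def)
      show "0 \<le> u j" if "j \<in> {0..n l}" for j
        using that nonneg[OF l, of j] le[OF l] pos[OF l] by (auto simp: u_def)
      show "y j \<in> convex hull B l" if "j \<in> {0..n l}" for j
        using that by (intro hull_inc) (auto simp: y_def B_def)
    qed auto
    also have "(\<Sum>j=0..n l. u j *\<^sub>R y j) = zb l"
      unfolding split0 zb_def using pos[OF l]
      by (auto simp: y_def u_def vec_eq_iff axis_def intro!: sum.cong)
    finally show ?thesis .
  qed
  ultimately have "z \<in> (\<Sum>l\<in>{1..s}. convex hull B l)"
    unfolding set_sum_alt[OF finite_atLeastAtMost] by blast
  then have "z \<in> convex hull (\<Sum>l\<in>{1..s}. B l)"
    by (simp add: convex_hull_set_sum)
  \<comment> \<open>One vertex per block adds up to a lattice point that meets all inequalities,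
    since distinct blocks share no coordinates.\<close>
  moreover have "(\<Sum>l\<in>{1..s}. B l) \<subseteq> simplex_support ix s n \<delta>"
  proof
    fix b assume "b \<in> (\<Sum>l\<in>{1..s}. B l)"
    then obtain y where y: "\<And>l. l \<in> {1..s} \<Longrightarrow> y l \<in> B l" and b: "b = (\<Sum>l\<in>{1..s}. y l)"
      unfolding set_sum_alt[OF finite_atLeastAtMost] by blast
    have comp: "b $ ix j l = y l $ ix j l" if jl: "l \<in> {1..s}" "j \<in> {1..n l}" for j l
    proof -
      have "y l' $ ix j l = 0" if "l' \<in> {1..s} - {l}" for l'
        using y[of l'] that jl by (auto simp: B_def axis_def ix_eq_iff)
      then have "(\<Sum>l'\<in>{1..s}. y l' $ ix j l) = y l $ ix j l"
        using jl by (simp add: sum.remove[of _ l])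
      then show ?thesis
        by (simp add: b)
    qed
    have int: "b $ k \<in> \<int>" for k
    proof -
      have "y l $ k \<in> \<int>" if "l \<in> {1..s}" for l
        using y[OF that] by (auto simp: B_def axis_def)
      then show ?thesis
        by (auto simp: b intro: Ints_sum)
    qed
    have block: "(\<forall>j\<in>{1..n l}. 0 \<le> y l $ ix j l) \<and> tail 1 l (y l) \<le> real (\<delta> l)"
      if l: "l \<in> {1..s}" for l
    proof (cases "y l = 0")
      case False
      then obtain j0 where j0: "j0 \<in> {1..n l}" "y l = axis (ix j0 l) (real (\<delta> l))"
        using y[OF l] by (auto simp: B_def)
      have "tail 1 l (y l) = (\<Sum>j=1..n l. if j = j0 then real (\<delta> l) else 0)"
        using j0 l by (intro sum.cong refl) (auto simp: axis_def ix_eq_iff)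
      then show ?thesis
        using j0 by (auto simp: axis_def)
    qed simp
    show "b \<in> simplex_support ix s n \<delta>"
      unfolding simplex_support_def lattice_points_def
      using int block comp by simp
  qed
  ultimately show ?thesis
    using hull_mono by blast
qed

text \<open>Provides the condition \<open>below\<close>: any decomposition \<open>y\<close> into box
  points of a point over the sum of simplices is replaced by the greedy one, whose summands lie in
  the simplices and whose lift is no higher.\<close>

lemma greedy_decomposition:
  fixes d :: "nat \<Rightarrow> nat \<Rightarrow> nat" and N :: nat
  assumes pos: "\<And>i l. i \<le> N \<Longrightarrow> l \<in> {1..s} \<Longrightarrow> 0 < d i l"
    and v: "\<And>j l. l \<in> {1..s} \<Longrightarrow> j \<in> {1..n l} \<Longrightarrow> v \<bullet> w_vec ix j l \<le> 0"
    and anti: "\<And>i. i < N \<Longrightarrow> lam (Suc i) \<le> lam i"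
    and y: "\<And>i. i \<le> N \<Longrightarrow> y i \<in> convex hull box_support ix s n (d i)"
    and x: "(\<Sum>i\<le>N. y i) \<in> sum_polytope {0..N} (\<lambda>i. simplex_support ix s n (d i))"
  shows "\<exists>z. (\<forall>i\<le>N. z i \<in> convex hull simplex_support ix s n (d i)) \<and>
    (\<Sum>i\<le>N. z i) = (\<Sum>i\<le>N. y i) \<and>
    (\<Sum>i\<le>N. lam i * (v \<bullet> z i)) \<le> (\<Sum>i\<le>N. lam i * (v \<bullet> y i))"
proof -
  define x where "x = (\<Sum>i\<le>N. y i)"
  define g where "g l = greedy (\<lambda>i. real (d i l))" for l
  have tail_x: "tail j l x = (\<Sum>i\<le>N. tail j l (y i))" for j l
    unfolding x_def by (rule linear_sum[OF linear_tail])
  \<comment> \<open>Here \<open>j\<close> runs one position past the block, so that differences of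
    consecutive tails are covered at the last position too.\<close>
  have tail_y: "0 \<le> tail j l (y i) \<and> tail j l (y i) \<le> real (d i l)"
    if "l \<in> {1..s}" "j \<in> {1..Suc (n l)}" "i \<le> N" for i j l
    using tail_hull_box_support[OF y[OF that(3)] that(1), of j] that(2)
    by (cases "j \<le> n l") auto
  have tail_x_nonneg: "0 \<le> tail j l x" if "l \<in> {1..s}" "j \<in> {1..Suc (n l)}" for j l
    unfolding tail_x by (rule sum_nonneg) (use tail_y that in auto)
  have tail_x_le: "tail j l x \<le> (\<Sum>i\<le>N. real (d i l))" if "l \<in> {1..s}" "j \<in> {1..Suc (n l)}" for j l
    unfolding tail_x by (rule sum_mono) (use tail_y that in auto)
  have x_nonneg: "0 \<le> x $ ix j l" if "l \<in> {1..s}" "j \<in> {1..n l}" for j l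
  proof -
    obtain a where a: "x = (\<Sum>i=0..N. a i)" "\<And>i. i \<in> {0..N} \<Longrightarrow> a i \<in> convex hull simplex_support ix s n (d i)"
      using x unfolding x_def sum_polytope_def set_sum_alt[OF finite_atLeastAtMost] by blast
    show ?thesis
      unfolding a(1) sum_component
      by (rule sum_nonneg) (rule component_hull_simplex_support[OF a(2) that])
  qed
  \<comment> \<open>The tails of \<open>x\<close> do not exceed the total capacity, so the
    truncation in \<open>sum_greedy\<close> has no effect.\<close>
  have sum_g: "(\<Sum>i\<le>N. g l i (tail j l x)) = tail j l x" if "l \<in> {1..s}" "j \<in> {1..Suc (n l)}" for j l
    unfolding g_def sum_greedy[OF tail_x_nonneg[OF that]] using tail_x_le[OF that] by simp
  \<comment> \<open>With components chosen as differences of consecutive shares, the tails of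
    \<open>z i\<close> telescope to the greedy shares of the tails of \<open>x\<close>.\<close>
  have "\<exists>z. \<forall>l\<in>{1..s}. \<forall>j\<in>{1..n l}. z $ ix j l = g l i (tail j l x) - g l i (tail (Suc j) l x)" for i
    using vec_from_blocks[of "\<lambda>j l. g l i (tail j l x) - g l i (tail (Suc j) l x)"] by metis
  then obtain z where z: "\<And>i j l. l \<in> {1..s} \<Longrightarrow> j \<in> {1..n l} \<Longrightarrow>
      z i $ ix j l = g l i (tail j l x) - g l i (tail (Suc j) l x)"
    by metis
  have tail_z: "tail j l (z i) = g l i (tail j l x)" if jl: "l \<in> {1..s}" "j \<in> {1..n l}" for i j l
  proof -
    have "tail j l (z i) = (\<Sum>J=j..n l. g l i (tail J l x) - g l i (tail (Suc J) l x))"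
      using jl z by (intro sum.cong) auto
    also have "\<dots> = g l i (tail j l x) - g l i (tail (Suc (n l)) l x)"
      using sum_Suc_diff[of j "n l" "\<lambda>J. - g l i (tail J l x)"] jl by simp
    also have "g l i (tail (Suc (n l)) l x) = 0"
      by (simp add: g_def greedy_0)
    finally show ?thesis by simp
  qed
  have "z i \<in> convex hull simplex_support ix s n (d i)" if i: "i \<le> N" for i
  proof (rule hull_simplex_supportI)
    show "0 < d i l" if "l \<in> {1..s}" for l
      using pos i that by blast
    \<comment> \<open>The components of \<open>x\<close> are nonnegative, so its tails do not
      increase with \<open>j\<close>; monotonicity of greedy filling passes this on to each
      share.\<close>
    show "0 \<le> z i $ ix j l" if jl: "l \<in> {1..s}" "j \<in> {1..n l}" for j l
      unfolding z[OF jl] g_def using x_nonneg[OF jl] tail_rec[OF jl(2), of x]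
      by (simp add: greedy_mono)
    show "tail 1 l (z i) \<le> real (d i l)" if l: "l \<in> {1..s}" for l
    proof (cases "n l = 0")
      case False
      then show ?thesis
        using tail_z[OF l, of 1 i] greedy_le[of "\<lambda>i. real (d i l)" i] by (simp add: g_def)
    qed simp
  qed
  moreover have "(\<Sum>i\<le>N. z i) = x"
  proof (rule vec_eq_iff[THEN iffD2], rule allI)
    fix k
    obtain j l where jl: "l \<in> {1..s}" "j \<in> {1..n l}" "k = ix j l"
      by (rule ix_cases)
    have "(\<Sum>i\<le>N. z i) $ k = (\<Sum>i\<le>N. g l i (tail j l x)) - (\<Sum>i\<le>N. g l i (tail (Suc j) l x))"
      using jl by (simp add: z sum_subtractf)
    also have "\<dots> = tail j l x - tail (Suc j) l x"
      using jl by (simp only: sum_g[OF jl(1)] atLeastAtMost_iff) (simp add: sum_g)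
    also have "\<dots> = x $ k"
      using tail_rec[OF jl(2), of x] jl(3) by simp
    finally show "(\<Sum>i\<le>N. z i) $ k = x $ k" .
  qed
  moreover have "(\<Sum>i\<le>N. lam i * (v \<bullet> z i)) \<le> (\<Sum>i\<le>N. lam i * (v \<bullet> y i))"
  proof -
    have swap: "(\<Sum>i\<le>N. lam i * (v \<bullet> b i))
      = (\<Sum>l=1..s. \<Sum>j=1..n l. (v \<bullet> w_vec ix j l) * (\<Sum>i\<le>N. lam i * tail j l (b i)))" for b
    proof -
      have "(\<Sum>i\<le>N. lam i * (v \<bullet> b i))
        = (\<Sum>i\<le>N. \<Sum>l=1..s. \<Sum>j=1..n l. (v \<bullet> w_vec ix j l) * (lam i * tail j l (b i)))"
        by (subst inner_eq_sum_tails) (simp add: sum_distrib_left mult.left_commute)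
      also have "\<dots> = (\<Sum>l=1..s. \<Sum>i\<le>N. \<Sum>j=1..n l. (v \<bullet> w_vec ix j l) * (lam i * tail j l (b i)))"
        by (rule sum.swap)
      also have "\<dots> = (\<Sum>l=1..s. \<Sum>j=1..n l. \<Sum>i\<le>N. (v \<bullet> w_vec ix j l) * (lam i * tail j l (b i)))"
        by (intro sum.cong refl sum.swap)
      finally show ?thesis
        by (simp only: sum_distrib_left)
    qed
    have le: "(\<Sum>i\<le>N. lam i * tail j l (y i)) \<le> (\<Sum>i\<le>N. lam i * tail j l (z i))"
      if jl: "l \<in> {1..s}" "j \<in> {1..n l}" for j l
      unfolding tail_z[OF jl] g_def tail_x
      using anti tail_y jl by (intro sum_greedy_optimal) auto
    \<comment> \<open>Greedy filling maximises each weighted sum of tails; the nonpositive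
      coefficients \<open>v \<bullet> w_vec ix j l\<close> turn this into a minimal lift.\<close>
    show ?thesis
      unfolding swap
      by (rule sum_mono, rule sum_mono, rule mult_left_mono_neg[OF le]) (simp_all add: v)
  qed
  ultimately show ?thesis
    unfolding x_def by blast
qed

end

section \<open>Comparison of the two mixed subdivisions\<close>

text \<open>Faces of \<open>\<Delta>\<close> enter the equality of complexes because plain
  intersections with \<open>\<Delta>\<close> need not be closed under faces. For cells with interior
  only \<open>\<Delta>\<close> itself can occur as the face, so there the equality is stated with
  plain intersections.\<close>

theorem theorem4p4:
  fixes ix :: "nat \<Rightarrow> nat \<Rightarrow> 'k::finite"
    and s :: nat and n :: "nat \<Rightarrow> nat" and N :: nat
    and d :: "nat \<Rightarrow> nat \<Rightarrow> nat"
    and v :: "real ^ 'k"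
  assumes "\<forall>l\<in>{1..s}. 0 < n l"
    and "N = (\<Sum>l=1..s. n l)"
    and "bij_betw (\<lambda>(j, l). ix j l) (block_index s n) UNIV"
    and "\<forall>i\<in>{0..N}. \<forall>l\<in>{1..s}. 0 < d i l"
    and "\<forall>l\<in>{1..s}. \<forall>j\<in>{1..n l}. v \<bullet> w_vec ix j l < 0"
  shows "\<exists>\<epsilon>>0. \<forall>lam :: nat \<Rightarrow> real.
    lam 0 < \<epsilon> \<and> (\<forall>i<N. lam (Suc i) < lam i) \<and> 0 \<le> lam N \<longrightarrow>
    (let A = (\<lambda>i. simplex_support ix s n (d i));
         A' = (\<lambda>i. box_support ix s n (d i));
         \<Delta> = sum_polytope {0..N} A;
         \<Delta>' = sum_polytope {0..N} A';
         \<omega> = (\<lambda>i x. lam i * (v \<bullet> x));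
         S = mixed_subdivision {0..N} A \<omega>;
         S' = mixed_subdivision {0..N} A' \<omega>
     in \<Delta> \<subseteq> \<Delta>' \<and>
        S = restrict_complex S' \<Delta> \<and>
        (\<forall>C\<in>S'. C \<inter> \<Delta> \<noteq> {} \<longrightarrow> C \<inter> \<Delta> \<in> S) \<and>
        {C \<in> S. interior C \<noteq> {}} = {C \<inter> \<Delta> | C. C \<in> S' \<and> interior (C \<inter> \<Delta>) \<noteq> {}})"
proof (intro exI[of _ 1] conjI allI impI)
  show "(1 :: real) > 0" by simp
next
  fix lam :: "nat \<Rightarrow> real"
  assume lam: "lam 0 < 1 \<and> (\<forall>i<N. lam (Suc i) < lam i) \<and> 0 \<le> lam N"
  interpret block_coordinates ix s n
    by unfold_locales (rule assms(3))
  define A where "A = (\<lambda>i. simplex_support ix s n (d i))"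
  define A' where "A' = (\<lambda>i. box_support ix s n (d i))"
  define \<omega> where "\<omega> = (\<lambda>i x. lam i * (v \<bullet> x))"
  have "A i \<subseteq> A' i" for i
    by (simp add: A_def A'_def simplex_support_subset_box_support)
  then have hull_subset: "convex hull A i \<subseteq> convex hull A' i" for i
    by (rule hull_mono)
  have finite_A': "finite (A' i)" for i
    by (simp add: A'_def finite_box_support)
  then have finite_A: "finite (A i)" for i
    using \<open>A i \<subseteq> A' i\<close> finite_subset by blast
  let ?P = "lifted_polytope {0..N} A \<omega>" and ?P' = "lifted_polytope {0..N} A' \<omega>"
  note lifted_iff = lifted_polytope_linear_iff[of "{0..N}", OF finite_atLeastAtMost]
  have fst_P: "fst ` ?P = sum_polytope {0..N} A" and fst_P': "fst ` ?P' = sum_polytope {0..N} A'"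
    unfolding \<omega>_def by (rule fst_lifted_polytope_linear[OF finite_atLeastAtMost])+
  interpret lower_hull_extension ?P ?P'
  proof
    show "polytope ?P" "polytope ?P'"
      by (intro polytope_lifted_polytope finite_A finite_A')+
    show "?P \<subseteq> ?P'"
    proof (rule subrelI)
      fix x t assume "(x, t) \<in> ?P"
      then show "(x, t) \<in> ?P'"
        unfolding \<omega>_def lifted_iff using hull_subset by blast
    qed
    show "\<exists>t'\<le>t. (x, t') \<in> ?P" if xt: "(x, t) \<in> ?P'" and x: "x \<in> fst ` ?P" for x t
    proof -
      obtain y where y: "\<And>i. i \<in> {0..N} \<Longrightarrow> y i \<in> convex hull A' i"
        and x_eq: "x = (\<Sum>i\<in>{0..N}. y i)" and t_eq: "t = (\<Sum>i\<in>{0..N}. lam i * (v \<bullet> y i))"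
        using xt unfolding \<omega>_def lifted_iff by blast
      have "\<exists>z. (\<forall>i\<le>N. z i \<in> convex hull simplex_support ix s n (d i)) \<and>
        (\<Sum>i\<le>N. z i) = (\<Sum>i\<le>N. y i) \<and>
        (\<Sum>i\<le>N. lam i * (v \<bullet> z i)) \<le> (\<Sum>i\<le>N. lam i * (v \<bullet> y i))"
      proof (rule greedy_decomposition)
        show "(\<Sum>i\<le>N. y i) \<in> sum_polytope {0..N} (\<lambda>i. simplex_support ix s n (d i))"
          using x unfolding fst_P by (simp add: x_eq A_def atLeast0AtMost)
        show "y i \<in> convex hull box_support ix s n (d i)" if "i \<le> N" for i
          using y[of i] that by (simp add: A'_def)
      qed (use assms(4,5) lam in \<open>auto simp: less_imp_le\<close>)
      then obtain z where z: "\<And>i. i \<le> N \<Longrightarrow> z i \<in> convex hull A i" "(\<Sum>i\<le>N. z i) = x"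
        "(\<Sum>i\<le>N. lam i * (v \<bullet> z i)) \<le> t"
        unfolding x_eq t_eq A_def atLeast0AtMost by blast
      then have "(x, \<Sum>i\<le>N. lam i * (v \<bullet> z i)) \<in> ?P"
        unfolding \<omega>_def lifted_iff by (intro exI[of _ z]) (simp add: atLeast0AtMost)
      with z(3) show ?thesis
        by blast
    qed
  qed
  have "sum_polytope {0..N} A \<subseteq> sum_polytope {0..N} A'"
    unfolding fst_P[symmetric] fst_P'[symmetric] using P_subset by (rule image_mono)
  \<comment> \<open>Folding turns the sets of projected lower faces into mixed subdivisions, and
    \<open>fst_P\<close> identifies the projection of the lifted sum with
    \<open>\<Delta>\<close>.\<close>
  moreover note lower_cells_eq_restrict_complex[folded mixed_subdivision_def, unfolded fst_P]
  ultimately show "let A = (\<lambda>i. simplex_support ix s n (d i));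
         A' = (\<lambda>i. box_support ix s n (d i));
         \<Delta> = sum_polytope {0..N} A;
         \<Delta>' = sum_polytope {0..N} A';
         \<omega> = (\<lambda>i x. lam i * (v \<bullet> x));
         S = mixed_subdivision {0..N} A \<omega>;
         S' = mixed_subdivision {0..N} A' \<omega>
     in \<Delta> \<subseteq> \<Delta>' \<and>
        S = restrict_complex S' \<Delta> \<and>
        (\<forall>C\<in>S'. C \<inter> \<Delta> \<noteq> {} \<longrightarrow> C \<inter> \<Delta> \<in> S) \<and>
        {C \<in> S. interior C \<noteq> {}} = {C \<inter> \<Delta> | C. C \<in> S' \<and> interior (C \<inter> \<Delta>) \<noteq> {}}"
    unfolding Let_def A_def[symmetric] A'_def[symmetric] \<omega>_def[symmetric]
    by (intro conjI ballI impI) assumption+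
qed

end
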